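(* In the ordinal setting on $n$ vertices, for every vector $\vec c=(c_1,\dots,c_n)\in[0,1]^n$, the algorithm $\mathrm{ALG}_{\vec c}$ matches the top two vertices (overall) to each other with probability at most $\frac{5}{12}+O(1/n)$, where the implied constant is absolute.
   Context: Ordinal setting: $n$ vertices are ranked by an unknown total ranking from 1st to $n$th (the 1st and 2nd overall are the top two vertices); they arrive in a uniformly random order $v_1,\dots,v_n$; upon arrival of $v_t$ the algorithm observes only the relative rank of $v_t$ among $v_1,\dots,v_t$ and must immediately and irrevocably decide whether to match it to an earlier unmatched vertex. For each $i$ let $\mathrm{I}_i,\mathrm{II}_i$ denote the highest- and second-highest-ranked vertices among $v_1,\dots,v_i$. Algorithm $\mathrm{ALG}_{\vec c}$: at each step $i$, if matching $\mathrm{I}_i$ with $\mathrm{II}_i$ is possible (that is, $v_i\in\{\mathrm{I}_i,\mathrm{II}_i\}$ and both $\mathrm{I}_i$ and $\mathrm{II}_i$ are unmatched), then with probability $c_i$ (independently) it matches $\mathrm{I}_i$ with $\mathrm{II}_i$; otherwise, and in all other steps, it matches nothing. The probability is over the random arrival order and the algorithm's randomness. *)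

theory Defs
  imports "HOL-Probability.Probability" "HOL-Combinatorics.Permutations"
begin

text \<open>
  A vertex is identified with its overall rank: the vertices are the elements of
  \<open>{1..n}\<close>, a smaller number is a higher rank, and the top two vertices are \<open>1\<close> and \<open>2\<close>.
  An arrival order is a permutation \<open>v\<close> of \<open>{1..n}\<close>, where \<open>v t\<close> is the vertex that
  arrives at step \<open>t\<close>. A matching is a set of edges, each edge a set of two vertices.
\<close>

definition arrival_order :: "nat \<Rightarrow> (nat \<Rightarrow> nat) pmf" where
  "arrival_order n = pmf_of_set {v. v permutes {1..n}}"

definition first_best :: "(nat \<Rightarrow> nat) \<Rightarrow> nat \<Rightarrow> nat" where
  "first_best v i = Min (v ` {1..i})"

text \<open>Meaningful for \<open>i \<ge> 2\<close> only.\<close>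

definition second_best :: "(nat \<Rightarrow> nat) \<Rightarrow> nat \<Rightarrow> nat" where
  "second_best v i = Min (v ` {1..i} - {first_best v i})"

definition can_match :: "(nat \<Rightarrow> nat) \<Rightarrow> nat set set \<Rightarrow> nat \<Rightarrow> bool" where
  "can_match v M i \<longleftrightarrow>
     2 \<le> i \<and> v i \<in> {first_best v i, second_best v i} \<and>
     first_best v i \<notin> \<Union>M \<and> second_best v i \<notin> \<Union>M"

text \<open>Distribution of the matching after step \<open>i\<close>, for a fixed arrival order \<open>v\<close>.\<close>

primrec ALG :: "(nat \<Rightarrow> real) \<Rightarrow> (nat \<Rightarrow> nat) \<Rightarrow> nat \<Rightarrow> nat set set pmf" where
  "ALG c v 0 = return_pmf {}"
| "ALG c v (Suc i) =
     bind_pmf (ALG c v i) (\<lambda>M.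
       if can_match v M (Suc i)
       then bind_pmf (bernoulli_pmf (c (Suc i))) (\<lambda>b.
              return_pmf (if b then insert {first_best v (Suc i), second_best v (Suc i)} M else M))
       else return_pmf M)"

definition ALG_matching :: "nat \<Rightarrow> (nat \<Rightarrow> real) \<Rightarrow> nat set set pmf" where
  "ALG_matching n c = bind_pmf (arrival_order n) (\<lambda>v. ALG c v n)"

end

theory Submission
  imports Defs "HOL-Combinatorics.Multiset_Permutations"
begin

text \<open>
  Whether the best vertex so far is unmatched evolves as follows at step \<open>i\<close>: a new best
  vertex is unmatched unless it is matched with the old best vertex on the spot; a new
  second-best vertex can only affect the best vertex by being matched with it; all other
  arrivals are irrelevant. Conditioning a uniformly random order of a set on its last element
  leaves a uniformly random order of the remaining set, so the probability \<open>p\<^sub>i\<close> that the best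
  of \<open>i\<close> vertices is unmatched satisfies \<open>i p\<^sub>i = (i - 1) p\<^sub>i\<^sub>-\<^sub>1 + 1 - 2 c\<^sub>i p\<^sub>i\<^sub>-\<^sub>1\<close>, and the
  probability \<open>q\<^sub>i\<close> that the top two of \<open>i\<close> vertices are matched to each other satisfies
  \<open>i q\<^sub>i = 2 c\<^sub>i p\<^sub>i\<^sub>-\<^sub>1 + (i - 2) q\<^sub>i\<^sub>-\<^sub>1\<close>. With \<open>y\<^sub>k = c\<^sub>k\<^sub>+\<^sub>1 p\<^sub>k\<close> this bounds \<open>n (n - 1) q\<^sub>n\<close> by the linear
  program that maximises the sum of \<open>2 k y\<^sub>k\<close> over \<open>y\<^sub>k \<ge> 0\<close> with
  \<open>k y\<^sub>k + 2 (y\<^sub>1 + \<dots> + y\<^sub>k\<^sub>-\<^sub>1) \<le> k\<close>, and an explicit dual solution bounds its value.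
\<close>

section \<open>The two smallest elements of a set under insertion of a new element\<close>

definition second_Min :: "nat set \<Rightarrow> nat" where
  "second_Min A = Min (A - {Min A})"

lemma second_best_eq: "second_best v i = second_Min (v ` {1..i})"
  by (simp add: second_best_def first_best_def second_Min_def)

lemma second_Min_in:
  assumes "finite A" "card A \<ge> 2"
  shows "second_Min A \<in> A" "second_Min A \<noteq> Min A"
proof -
  have "Min A \<in> A" using assms by (metis Min_in card.empty not_numeral_le_zero)
  with assms have "card (A - {Min A}) \<ge> 1" by simp
  hence "A - {Min A} \<noteq> {}" by (metis card.empty not_one_le_zero)
  hence "second_Min A \<in> A - {Min A}"
    unfolding second_Min_def using assms by (intro Min_in) auto
  thus "second_Min A \<in> A" "second_Min A \<noteq> Min A" by auto
qed

lemma Min_insert_other: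
  assumes "finite S" "S \<noteq> {}" "x \<notin> S" "x \<noteq> Min (insert x S)"
  shows "Min (insert x S) = Min S"
  using assms by (auto simp: min_def split: if_splits)

lemma second_Min_insert_Min:
  assumes "finite S" "S \<noteq> {}" "x \<notin> S" "x = Min (insert x S)"
  shows "second_Min (insert x S) = Min S"
  using assms unfolding second_Min_def by (metis Diff_insert_absorb)

text \<open>Once the minimum is removed, the new element is still not minimal, so inserting it does
  not move the minimum of the rest.\<close>

lemma second_Min_insert_other:
  assumes "finite S" "S \<noteq> {}" "x \<notin> S" "x \<noteq> Min (insert x S)" "x \<noteq> second_Min (insert x S)"
  shows "second_Min (insert x S) = second_Min S"
proof -
  have m: "Min (insert x S) = Min S" by (rule Min_insert_other) fact+
  hence s: "second_Min (insert x S) = Min (insert x (S - {Min S}))"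
    using assms unfolding second_Min_def m by (simp add: insert_Diff_if)
  have *: "S \<noteq> {Min S}"
  proof
    assume "S = {Min S}"
    hence "S - {Min S} = {}" by blast
    with s have "second_Min (insert x S) = x" by simp
    with assms show False by simp
  qed
  have "S - {Min S} \<noteq> {}" using * assms by (metis Diff_eq_empty_iff Min_in insert_subset singletonD
        subsetI subset_antisym subset_singletonD)
  hence "Min (insert x (S - {Min S})) = Min (S - {Min S})"
    using s assms by (intro Min_insert_other) auto
  with s show "second_Min (insert x S) = second_Min S" by (simp add: second_Min_def)
qed

section \<open>The algorithm on a fixed arrival order\<close>

text \<open>
  Lists of arrivals are in reverse order: the head is the last arrival. The value \<open>0\<close> for
  the empty list makes the general rule yield \<open>1\<close> for a single vertex, which is always unmatched.
\<close>

fun free_prob :: "(nat \<Rightarrow> real) \<Rightarrow> nat list \<Rightarrow> real" where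
  "free_prob c [] = 0"
| "free_prob c (x # xs) =
     (if x = Min (set (x # xs)) then 1 - c (length (x # xs)) * free_prob c xs
      else if x = second_Min (set (x # xs)) then (1 - c (length (x # xs))) * free_prob c xs
      else free_prob c xs)"

text \<open>A newcomer in the top two forms the top pair with the old best and is itself unmatched,
  so only the old best has to be free. Any other arrival leaves the pair and its status alone. For a
  single vertex the value \<open>0\<close> of \<open>free_prob\<close> on the empty list gives
  \<open>0\<close>.\<close>

fun match_prob :: "(nat \<Rightarrow> real) \<Rightarrow> nat list \<Rightarrow> real" where
  "match_prob c [] = 0"
| "match_prob c (x # xs) =
     (if x \<in> {Min (set (x # xs)), second_Min (set (x # xs))}
      then c (length (x # xs)) * free_prob c xs else match_prob c xs)"

lemma prob_bind_pmf:
  "measure_pmf.prob (bind_pmf M f) X = measure_pmf.expectation M (\<lambda>x. measure_pmf.prob (f x) X)"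
  unfolding measure_pmf_bind
  by (subst measure_pmf.measure_bind[where N="count_space UNIV"])
     (auto simp: measure_subprob)

lemma prob_eq_expectation:
  "measure_pmf.prob D {M. P M} = measure_pmf.expectation D (\<lambda>M. of_bool (P M))"
proof -
  have "(\<lambda>M. of_bool (P M)) = (indicator {M. P M} :: _ \<Rightarrow> real)" by (auto simp: indicator_def)
  thus ?thesis by simp
qed

lemma integrable_of_bool [simp]: "integrable (measure_pmf D) (\<lambda>M. of_bool (P M) :: real)"
  by (rule measure_pmf.integrable_const_bound[where B=1]) auto

lemma prob_return: "measure_pmf.prob (return_pmf x) {M. P M} = of_bool (P x)"
  by (simp add: measure_return_pmf)

lemma prob_ALG_Suc:
  assumes "c (Suc i) \<in> {0..1}"
  shows "measure_pmf.prob (ALG c v (Suc i)) {M. P M} =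
    measure_pmf.expectation (ALG c v i) (\<lambda>M.
      if can_match v M (Suc i)
      then c (Suc i) * of_bool (P (insert {first_best v (Suc i), second_best v (Suc i)} M)) +
           (1 - c (Suc i)) * of_bool (P M)
      else of_bool (P M))"
  unfolding ALG.simps prob_bind_pmf
  by (rule Bochner_Integration.integral_cong)
     (use assms in \<open>auto simp: prob_bind_pmf prob_return\<close>)

text \<open>In every case of a step, the event after it has a conditional probability that is affine
  in the indicator of one event before it. The recursions thus reduce to a pointwise check on the
  support.\<close>

lemma prob_ALG_Suc':
  assumes "c (Suc i) \<in> {0..1}"
    and "\<And>M. M \<in> set_pmf (ALG c v i) \<Longrightarrow>
      (if can_match v M (Suc i)
      then c (Suc i) * of_bool (P (insert {first_best v (Suc i), second_best v (Suc i)} M)) +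
           (1 - c (Suc i)) * of_bool (P M)
      else of_bool (P M)) = a + b * of_bool (Q M)"
  shows "measure_pmf.prob (ALG c v (Suc i)) {M. P M} = a + b * measure_pmf.prob (ALG c v i) {M. Q M}"
proof -
  have "measure_pmf.prob (ALG c v (Suc i)) {M. P M} =
    measure_pmf.expectation (ALG c v i) (\<lambda>M. a + b * of_bool (Q M))"
    unfolding prob_ALG_Suc[of c i, OF assms(1)]
    by (rule integral_cong_AE) (use assms(2) in \<open>auto simp: AE_measure_pmf_iff\<close>)
  also have "\<dots> = a + b * measure_pmf.prob (ALG c v i) {M. Q M}"
    unfolding prob_eq_expectation by (subst Bochner_Integration.integral_add) auto
  finally show ?thesis .
qed

text \<open>Ensures that the next arrival is still unmatched. Injectivity makes the set of arrivals
  large enough for its second best to be a member.\<close>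

lemma Union_ALG_subset:
  assumes "M \<in> set_pmf (ALG c v i)" "inj_on v {1..i}"
  shows "\<Union>M \<subseteq> v ` {1..i}"
  using assms
proof (induction i arbitrary: M)
  case (Suc i)
  have inj: "inj_on v {1..i}" using Suc.prems(2) by (rule inj_on_subset) auto
  have mono: "v ` {1..i} \<subseteq> v ` {1..Suc i}" by auto
  have new: "{first_best v (Suc i), second_best v (Suc i)} \<subseteq> v ` {1..Suc i}" if "Suc i \<ge> 2"
  proof -
    have "card (v ` {1..Suc i}) = Suc i" using Suc.prems(2) by (simp add: card_image)
    with that second_Min_in[of "v ` {1..Suc i}"] Min_in[of "v ` {1..Suc i}"] show ?thesis
      unfolding second_best_eq first_best_def by auto
  qed
  from Suc.prems(1) obtain M' where M': "M' \<in> set_pmf (ALG c v i)" and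
    "M = M' \<or> can_match v M' (Suc i) \<and> M = insert {first_best v (Suc i), second_best v (Suc i)} M'"
    by (auto split: if_splits)
  thus ?case using Suc.IH[OF M' inj] mono new by (auto simp: can_match_def)
qed auto

definition arrivals :: "(nat \<Rightarrow> nat) \<Rightarrow> nat \<Rightarrow> nat list" where
  "arrivals v i = rev (map v [1..<Suc i])"

lemma arrivals_0 [simp]: "arrivals v 0 = []"
  by (simp add: arrivals_def)

lemma arrivals_Suc [simp]: "arrivals v (Suc i) = v (Suc i) # arrivals v i"
  by (simp add: arrivals_def)

lemma set_arrivals [simp]: "set (arrivals v i) = v ` {1..i}"
  by (auto simp: arrivals_def)

lemma length_arrivals [simp]: "length (arrivals v i) = i"
  by (simp add: arrivals_def)

text \<open>Both claims share one induction, since matching the top pair requires the old best to be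
  free. It starts at step 1 because the best of no arrivals is undefined.\<close>

lemma ALG_free_and_match_prob:
  assumes "i \<ge> 1" "inj_on v {1..i}" "\<And>j. j \<in> {1..i} \<Longrightarrow> c j \<in> {0..1}"
  shows "measure_pmf.prob (ALG c v i) {M. first_best v i \<notin> \<Union>M} = free_prob c (arrivals v i) \<and>
    measure_pmf.prob (ALG c v i) {M. {first_best v i, second_best v i} \<in> M} = match_prob c (arrivals v i)"
  using assms
proof (induction i rule: nat_induct_at_least)
  case base
  have "ALG c v 1 = return_pmf {}" by (simp add: can_match_def bind_return_pmf)
  thus ?case using base by (simp add: prob_return)
next
  case (Suc i)
  define S where "S = v ` {1..i}"
  define x where "x = v (Suc i)"
  have ins: "v ` {1..Suc i} = insert x S" by (auto simp: S_def x_def atLeastAtMostSuc_conv)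
  have S: "finite S" "S \<noteq> {}" using Suc.hyps by (auto simp: S_def)
  have x: "x \<notin> S" using Suc.prems(1) unfolding S_def x_def by (auto dest: inj_onD)
  have inj: "inj_on v {1..i}" using Suc.prems(1) by (rule inj_on_subset) auto
  have c: "c (Suc i) \<in> {0..1}" using Suc.prems(2) by simp
  have IH: "measure_pmf.prob (ALG c v i) {M. Min S \<notin> \<Union>M} = free_prob c (arrivals v i)"
    "measure_pmf.prob (ALG c v i) {M. {Min S, second_Min S} \<in> M} = match_prob c (arrivals v i)"
    using Suc.IH[OF inj] Suc.prems(2) by (auto simp: first_best_def second_best_eq S_def)
  have sub: "\<Union>M \<subseteq> S" if "M \<in> set_pmf (ALG c v i)" for M
    using Union_ALG_subset[OF that inj] by (simp add: S_def)
  have fb: "first_best v (Suc i) = Min (insert x S)" by (simp only: first_best_def ins)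
  have sb: "second_best v (Suc i) = second_Min (insert x S)" by (simp only: second_best_eq ins)
  have "insert (v (Suc i)) (v ` {1..i}) = insert x S" by (simp add: x_def S_def)
  hence rec: "free_prob c (arrivals v (Suc i)) =
      (if x = Min (insert x S) then 1 - c (Suc i) * free_prob c (arrivals v i)
       else if x = second_Min (insert x S) then (1 - c (Suc i)) * free_prob c (arrivals v i)
       else free_prob c (arrivals v i))"
    "match_prob c (arrivals v (Suc i)) =
      (if x \<in> {Min (insert x S), second_Min (insert x S)}
       then c (Suc i) * free_prob c (arrivals v i) else match_prob c (arrivals v i))"
    by (simp_all add: x_def)
  have cm: "can_match v M (Suc i) \<longleftrightarrow> x \<in> {Min (insert x S), second_Min (insert x S)} \<and>
     Min (insert x S) \<notin> \<Union>M \<and> second_Min (insert x S) \<notin> \<Union>M" for M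
    using Suc.hyps by (simp add: can_match_def fb sb x_def)
  consider "x = Min (insert x S)" | "x \<noteq> Min (insert x S)" "x = second_Min (insert x S)"
    | "x \<noteq> Min (insert x S)" "x \<noteq> second_Min (insert x S)" by blast
  thus ?case
  proof cases
    case 1
    have s: "second_Min (insert x S) = Min S" by (rule second_Min_insert_Min[OF S x 1])
    \<comment> \<open>The new best \<open>x\<close> gets matched only if the old best is free and
      the coin succeeds. No edge of \<open>M\<close> contains \<open>x\<close>, so its edge to the
      old best cannot be present already.\<close>
    have "measure_pmf.prob (ALG c v (Suc i)) {M. first_best v (Suc i) \<notin> \<Union>M} =
      1 + (- c (Suc i)) * measure_pmf.prob (ALG c v i) {M. Min S \<notin> \<Union>M}"
      by (rule prob_ALG_Suc'[where c = c and i = i, OF c]) (use sub x in \<open>auto simp: cm fb sb s 1[symmetric]\<close>)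
    moreover have "measure_pmf.prob (ALG c v (Suc i)) {M. {first_best v (Suc i), second_best v (Suc i)} \<in> M} =
      0 + c (Suc i) * measure_pmf.prob (ALG c v i) {M. Min S \<notin> \<Union>M}"
      by (rule prob_ALG_Suc'[where c = c and i = i, OF c]) (use sub x in \<open>auto simp: cm fb sb s 1[symmetric]\<close>)
    ultimately show ?thesis unfolding rec IH using 1 by (simp del: ALG.simps)
  next
    case 2
    have f: "Min (insert x S) = Min S" by (rule Min_insert_other[OF S x 2(1)])
    have "measure_pmf.prob (ALG c v (Suc i)) {M. first_best v (Suc i) \<notin> \<Union>M} =
      0 + (1 - c (Suc i)) * measure_pmf.prob (ALG c v i) {M. Min S \<notin> \<Union>M}"
      by (rule prob_ALG_Suc'[where c = c and i = i, OF c]) (use sub x in \<open>auto simp: cm fb sb f 2(2)[symmetric]\<close>)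
    moreover have "measure_pmf.prob (ALG c v (Suc i)) {M. {first_best v (Suc i), second_best v (Suc i)} \<in> M} =
      0 + c (Suc i) * measure_pmf.prob (ALG c v i) {M. Min S \<notin> \<Union>M}"
      by (rule prob_ALG_Suc'[where c = c and i = i, OF c]) (use sub x in \<open>auto simp: cm fb sb f 2(2)[symmetric]\<close>)
    ultimately show ?thesis unfolding rec IH using 2 by (simp del: ALG.simps)
  next
    case 3
    have f: "Min (insert x S) = Min S" by (rule Min_insert_other[OF S x 3(1)])
    have s: "second_Min (insert x S) = second_Min S" by (rule second_Min_insert_other[OF S x 3])
    have "measure_pmf.prob (ALG c v (Suc i)) {M. first_best v (Suc i) \<notin> \<Union>M} =
      0 + 1 * measure_pmf.prob (ALG c v i) {M. Min S \<notin> \<Union>M}"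
      by (rule prob_ALG_Suc'[where c = c and i = i, OF c]) (use 3 in \<open>auto simp: cm fb sb f s\<close>)
    moreover have "measure_pmf.prob (ALG c v (Suc i)) {M. {first_best v (Suc i), second_best v (Suc i)} \<in> M} =
      0 + 1 * measure_pmf.prob (ALG c v i) {M. {Min S, second_Min S} \<in> M}"
      by (rule prob_ALG_Suc'[where c = c and i = i, OF c]) (use 3 in \<open>auto simp: cm fb sb f s\<close>)
    ultimately show ?thesis unfolding rec IH using 3 by (simp del: ALG.simps)
  qed
qed

section \<open>Averaging over uniformly random arrival orders\<close>

text \<open>Injectivity and the common cardinality \<open>fact n\<close> give surjectivity. On lists
  the last arrival can be split off as the head.\<close>

lemma bij_betw_arrivals:
  "bij_betw (\<lambda>v. arrivals v n) {v. v permutes {1..n}} (permutations_of_set {1..n})"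
proof -
  have inj: "inj_on (\<lambda>v. arrivals v n) {v. v permutes {1..n}}"
  proof (rule inj_onI)
    fix v w assume vw: "v \<in> {v. v permutes {1..n}}" "w \<in> {v. v permutes {1..n}}"
      and "arrivals v n = arrivals w n"
    hence "map v [1..<Suc n] = map w [1..<Suc n]" by (simp add: arrivals_def del: upt_Suc)
    hence "v k = w k" if "k \<in> {1..n}" for k using that by (auto simp del: upt_Suc)
    moreover have "v k = w k" if "k \<notin> {1..n}" for k using that vw by (auto simp: permutes_not_in)
    ultimately show "v = w" by blast
  qed
  have sub: "(\<lambda>v. arrivals v n) ` {v. v permutes {1..n}} \<subseteq> permutations_of_set {1..n}"
  proof safe
    fix v assume v: "v permutes {1..n}"
    show "arrivals v n \<in> permutations_of_set {1..n}"
    proof (rule permutations_of_setI)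
      show "set (arrivals v n) = {1..n}" using permutes_image[OF v] by simp
      show "distinct (arrivals v n)"
        using permutes_inj[OF v] by (auto simp: arrivals_def distinct_map intro: inj_on_subset)
    qed
  qed
  have "card ((\<lambda>v. arrivals v n) ` {v. v permutes {1..n}}) = card (permutations_of_set {1..n})"
    using inj by (simp add: card_image card_permutations)
  with sub have "(\<lambda>v. arrivals v n) ` {v. v permutes {1..n}} = permutations_of_set {1..n}"
    by (intro card_subset_eq) auto
  with inj show ?thesis by (simp add: bij_betw_def)
qed

text \<open>\<open>free_avg\<close> and \<open>match_avg\<close> are \<open>p\<^sub>i\<close> and
  \<open>q\<^sub>i\<close>, given by their recurrences and identified as averages
  afterwards.\<close>

fun free_avg :: "(nat \<Rightarrow> real) \<Rightarrow> nat \<Rightarrow> real" where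
  "free_avg c 0 = 0"
| "free_avg c (Suc i) = (if i = 0 then 1 else
     (real i * free_avg c i + 1 - 2 * c (Suc i) * free_avg c i) / real (Suc i))"

fun match_avg :: "(nat \<Rightarrow> real) \<Rightarrow> nat \<Rightarrow> real" where
  "match_avg c 0 = 0"
| "match_avg c (Suc i) = (if i = 0 then 0 else
     (2 * c (Suc i) * free_avg c i + (real i - 1) * match_avg c i) / real (Suc i))"

lemma sum_permutations_of_set_Cons:
  assumes "finite A" "A \<noteq> {}"
  shows "sum f (permutations_of_set A) = (\<Sum>x\<in>A. \<Sum>xs\<in>permutations_of_set (A - {x}). f (x # xs))"
proof -
  have "sum f (permutations_of_set A) = (\<Sum>x\<in>A. sum f ((#) x ` permutations_of_set (A - {x})))"
    unfolding permutations_of_set_nonempty[OF assms(2)]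
    by (rule sum.UNION_disjoint) (use assms in auto)
  also have "\<dots> = (\<Sum>x\<in>A. \<Sum>xs\<in>permutations_of_set (A - {x}). f (x # xs))"
    by (rule sum.cong[OF refl]) (simp add: sum.reindex)
  finally show ?thesis .
qed

lemma sum_top_two:
  fixes A :: "nat set" and F :: "nat \<Rightarrow> real"
  assumes "finite A" "card A \<ge> 2"
    and "\<And>x. x \<in> A \<Longrightarrow> x \<noteq> Min A \<Longrightarrow> x \<noteq> second_Min A \<Longrightarrow> F x = b"
  shows "sum F A = F (Min A) + F (second_Min A) + (real (card A) - 2) * b"
proof -
  have A: "Min A \<in> A" using assms by (metis Min_in card.empty not_numeral_le_zero)
  note s = second_Min_in[OF assms(1,2)]
  let ?B = "A - {Min A} - {second_Min A}"
  have "sum F A = F (Min A) + sum F (A - {Min A})" using A assms(1) by (simp add: sum.remove)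
  also have "sum F (A - {Min A}) = F (second_Min A) + sum F ?B"
    using s assms(1) by (intro sum.remove) auto
  also have "sum F ?B = (\<Sum>x\<in>?B. b)" using assms(3) by (intro sum.cong) auto
  also have "\<dots> = (real (card A) - 2) * b" using A s assms by (simp add: of_nat_diff)
  finally show ?thesis by simp
qed

text \<open>Each choice of the last arrival leaves all orders of a set with one element less, hence
  the induction over arbitrary \<open>A\<close>. The best, the second best and the remaining choices
  yield the terms of the recurrences.\<close>

lemma sum_free_and_match_prob:
  assumes "finite A" "card A = i"
  shows "(\<Sum>xs\<in>permutations_of_set A. free_prob c xs) = fact i * free_avg c i \<and>
    (\<Sum>xs\<in>permutations_of_set A. match_prob c xs) = fact i * match_avg c i"
  using assms
proof (induction i arbitrary: A)
  case 0
  thus ?case by simp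
next
  case (Suc i)
  have A: "A \<noteq> {}" using Suc.prems by auto
  show ?case
  proof (cases "i = 0")
    case True
    then obtain x where "A = {x}" using Suc.prems by (metis One_nat_def card_1_singletonE)
    thus ?thesis using True by simp
  next
    case False
    define F where "F x = (\<Sum>xs\<in>permutations_of_set (A - {x}). free_prob c (x # xs))" for x
    define G where "G x = (\<Sum>xs\<in>permutations_of_set (A - {x}). match_prob c (x # xs))" for x
    have card2: "card A \<ge> 2" using Suc.prems False by simp
    note s = second_Min_in[OF Suc.prems(1) card2]
    have MinA: "Min A \<in> A" using A Suc.prems by simp
    have IH: "(\<Sum>xs\<in>permutations_of_set (A - {x}). free_prob c xs) = fact i * free_avg c i"
      "(\<Sum>xs\<in>permutations_of_set (A - {x}). match_prob c xs) = fact i * match_avg c i" if "x \<in> A" for x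
      using Suc.IH[of "A - {x}"] Suc.prems that by auto
    have cp: "card (permutations_of_set (A - {x})) = fact i" if "x \<in> A" for x
      using Suc.prems that by simp
    have xs: "set (x # xs) = A" "length (x # xs) = Suc i"
      if "x \<in> A" "xs \<in> permutations_of_set (A - {x})" for x xs
      using that Suc.prems permutations_of_setD[OF that(2)] length_finite_permutations_of_set[OF that(2)]
      by (auto simp: card_Suc_Diff1)
    have F1: "F (Min A) = fact i * (1 - c (Suc i) * free_avg c i)"
    proof -
      have "F (Min A) = (\<Sum>xs\<in>permutations_of_set (A - {Min A}). 1 - c (Suc i) * free_prob c xs)"
        unfolding F_def by (intro sum.cong refl) (use xs[OF MinA] in \<open>simp del: list.set list.size\<close>)
      thus ?thesis using IH[OF MinA] cp[OF MinA]
        by (simp add: sum_subtractf flip: sum_distrib_left) (simp add: algebra_simps)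
    qed
    have F2: "F (second_Min A) = fact i * ((1 - c (Suc i)) * free_avg c i)"
    proof -
      have "F (second_Min A) = (\<Sum>xs\<in>permutations_of_set (A - {second_Min A}). (1 - c (Suc i)) * free_prob c xs)"
        unfolding F_def by (intro sum.cong refl) (use xs[OF s(1)] s(2) in \<open>simp del: list.set list.size\<close>)
      thus ?thesis using IH[OF s(1)] by (simp flip: sum_distrib_left)
    qed
    have F3: "F x = fact i * free_avg c i" if "x \<in> A" "x \<noteq> Min A" "x \<noteq> second_Min A" for x
    proof -
      have "F x = (\<Sum>xs\<in>permutations_of_set (A - {x}). free_prob c xs)"
        unfolding F_def by (intro sum.cong refl) (use xs[OF that(1)] that in \<open>simp del: list.set list.size\<close>)
      thus ?thesis using IH[OF that(1)] by simp
    qed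
    have G12: "G x = fact i * (c (Suc i) * free_avg c i)" if "x \<in> A" "x \<in> {Min A, second_Min A}" for x
    proof -
      have "G x = (\<Sum>xs\<in>permutations_of_set (A - {x}). c (Suc i) * free_prob c xs)"
        unfolding G_def by (intro sum.cong refl) (use xs[OF that(1)] that in \<open>simp del: list.set list.size\<close>)
      thus ?thesis using IH[OF that(1)] by (simp flip: sum_distrib_left)
    qed
    have G3: "G x = fact i * match_avg c i" if "x \<in> A" "x \<noteq> Min A" "x \<noteq> second_Min A" for x
    proof -
      have "G x = (\<Sum>xs\<in>permutations_of_set (A - {x}). match_prob c xs)"
        unfolding G_def by (intro sum.cong refl) (use xs[OF that(1)] that in \<open>simp del: list.set list.size\<close>)
      thus ?thesis using IH[OF that(1)] by simp
    qed
    have "(\<Sum>xs\<in>permutations_of_set A. free_prob c xs) = sum F A"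
      unfolding F_def by (rule sum_permutations_of_set_Cons[OF Suc.prems(1) A])
    also have "\<dots> = F (Min A) + F (second_Min A) + (real (card A) - 2) * (fact i * free_avg c i)"
      by (rule sum_top_two[OF Suc.prems(1) card2 F3])
    also have "\<dots> = fact i * (real i * free_avg c i + 1 - 2 * c (Suc i) * free_avg c i)"
      unfolding F1 F2 Suc.prems(2) by (simp add: algebra_simps)
    also have "\<dots> = fact (Suc i) * free_avg c (Suc i)" using False by (simp add: field_simps)
    finally have 1: "(\<Sum>xs\<in>permutations_of_set A. free_prob c xs) = fact (Suc i) * free_avg c (Suc i)" .
    have "(\<Sum>xs\<in>permutations_of_set A. match_prob c xs) = sum G A"
      unfolding G_def by (rule sum_permutations_of_set_Cons[OF Suc.prems(1) A])
    also have "\<dots> = G (Min A) + G (second_Min A) + (real (card A) - 2) * (fact i * match_avg c i)"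
      by (rule sum_top_two[OF Suc.prems(1) card2 G3])
    also have "\<dots> = fact i * (2 * c (Suc i) * free_avg c i + (real i - 1) * match_avg c i)"
      using G12[OF MinA] G12[OF s(1)] unfolding Suc.prems(2) by (simp add: algebra_simps)
    also have "\<dots> = fact (Suc i) * match_avg c (Suc i)" using False by (simp add: field_simps)
    finally show ?thesis using 1 by blast
  qed
qed

lemma prob_ALG_matching:
  assumes "n \<ge> 2" "\<And>i. i \<in> {1..n} \<Longrightarrow> c i \<in> {0..1}"
  shows "measure_pmf.prob (ALG_matching n c) {M. {1, 2} \<in> M} = match_avg c n"
proof -
  let ?P = "{v. v permutes {1..n}}"
  have P: "finite ?P" "?P \<noteq> {}" "card ?P = fact n"
    using permutes_id[of "{1..n}"] by (blast intro: finite_permutations, blast, simp add: card_permutations)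
  have Min: "Min {1..n} = 1" using assms by (intro Min_eqI) auto
  have "{1..n} - {1} = {2..n}" by auto
  hence sec: "second_Min {1..n} = 2" unfolding second_Min_def Min using assms by (auto intro!: Min_eqI)
  have prob: "measure_pmf.prob (ALG c v n) {M. {1, 2} \<in> M} = match_prob c (arrivals v n)"
    if "v \<in> ?P" for v
  proof -
    have v: "v permutes {1..n}" using that by simp
    have "first_best v n = 1" "second_best v n = 2"
      using permutes_image[OF v] Min sec by (simp_all add: first_best_def second_best_eq)
    moreover have "inj_on v {1..n}" using permutes_inj[OF v] by (rule inj_on_subset) simp
    ultimately show ?thesis using ALG_free_and_match_prob[of n v c] assms by simp
  qed
  have "measure_pmf.prob (ALG_matching n c) {M. {1, 2} \<in> M} =
    (\<Sum>v\<in>?P. measure_pmf.prob (ALG c v n) {M. {1, 2} \<in> M}) / fact n"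
    unfolding ALG_matching_def arrival_order_def prob_bind_pmf using P by (simp add: integral_pmf_of_set)
  also have "(\<Sum>v\<in>?P. measure_pmf.prob (ALG c v n) {M. {1, 2} \<in> M}) = (\<Sum>v\<in>?P. match_prob c (arrivals v n))"
    using prob by (rule sum.cong[OF refl])
  also have "\<dots> = (\<Sum>xs\<in>permutations_of_set {1..n}. match_prob c xs)"
    by (rule sum.reindex_bij_betw[OF bij_betw_arrivals])
  also have "\<dots> = fact n * match_avg c n" using sum_free_and_match_prob[of "{1..n}" n c] by simp
  finally show ?thesis by simp
qed


section \<open>A linear program and its dual bound\<close>

text \<open>
  The dual weights are \<open>w k\<close> for \<open>k > m\<close> and zero otherwise, where \<open>w\<close> solves
  \<open>k w\<^sub>k + 2 (w\<^sub>k\<^sub>+\<^sub>1 + \<dots> + w\<^sub>n\<^sub>-\<^sub>1) = 2 k\<close>; \<open>\<beta> k\<close> is twice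
  the sum of the weights after \<open>k\<close>, and \<open>\<alpha> k\<close> the sum of \<open>j w\<^sub>j\<close> over \<open>j > k\<close>. Thus \<open>\<alpha> k - \<beta> k * S k\<close>
  bounds what can still be gained after \<open>k\<close>.
\<close>

lemma matching_lp_bound:
  fixes y :: "nat \<Rightarrow> real"
  assumes n: "n \<ge> 3" and y: "\<And>k. k \<in> {1..<n} \<Longrightarrow> y k \<ge> 0"
    and cap: "\<And>k. k \<in> {1..<n} \<Longrightarrow> real k * y k + 2 * (\<Sum>j=1..<k. y j) \<le> real k"
  shows "(\<Sum>k=1..<n. 2 * real k * y k) \<le> real n * (real n - 1) * (5 / 12 + 1 / real n)"
proof -
  define N where "N = real n"
  \<comment> \<open>\<open>w\<close> changes sign at \<open>N / 2\<close>, so all weights beyond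
    \<open>m\<close> are nonnegative.\<close>
  define m where "m = n div 2"
  define w where "w k = (4 * real k - 2 * N) / (N - 2)" for k
  define \<beta> where "\<beta> k = 4 * real k * (N - 1 - real k) / (N - 2)" for k
  \<comment> \<open>The closed form comes from the formulas for sums of \<open>j\<close> and of
    \<open>j\<^sup>2\<close> up to \<open>n - 1\<close> and up to \<open>k\<close>.\<close>
  define \<alpha> where "\<alpha> k = (2 / 3 * ((N - 1) * N * (2 * N - 1) - real k * (real k + 1) * (2 * real k + 1))
    - N * (N * (N - 1) - real k * (real k + 1))) / (N - 2)" for k
  define S where "S k = (\<Sum>j=1..k. y j)" for k
  define R where "R k = (\<Sum>j=1..k. 2 * real j * y j)" for k
  have N: "N \<ge> 3" using n by (simp add: N_def)
  have m: "m \<ge> 1" "m < n" using n by (auto simp: m_def)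
  have Nm: "N = 2 * real m \<or> N = 2 * real m + 1"
  proof -
    have "n = 2 * m \<or> n = 2 * m + 1" unfolding m_def by presburger
    thus ?thesis unfolding N_def by auto
  qed
  have S_nonneg: "S k \<ge> 0" if "k < n" for k
    unfolding S_def using that y by (intro sum_nonneg) auto
  have \<beta>_Suc: "\<beta> k = \<beta> (Suc k) + 2 * w (Suc k)" for k
    using N by (simp add: \<beta>_def w_def divide_simps) algebra
  have \<alpha>_Suc: "\<alpha> k = \<alpha> (Suc k) + real (Suc k) * w (Suc k)" for k
    using N by (simp add: \<alpha>_def w_def divide_simps) algebra
  have tight: "real k * w k + \<beta> k = 2 * real k" for k
    using N by (simp add: \<beta>_def w_def divide_simps) algebra
  \<comment> \<open>Gain so far plus the bound on the future gain does not increase from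
    \<open>m\<close> on; at \<open>n - 1\<close> it is the whole objective.\<close>
  have "R k + \<alpha> k - \<beta> k * S k \<le> \<alpha> m" if "k \<ge> m" "k < n" for k
    using that
  proof (induction k rule: nat_induct_at_least)
    case base
    \<comment> \<open>Without dual weights up to \<open>m\<close>, every coefficient there must be
      at most \<open>\<beta> m\<close>; the largest is \<open>2 * real m\<close>, and
      \<open>2 * real m \<le> N\<close> suffices.\<close>
    have "R m \<le> (\<Sum>j=1..m. 2 * real m * y j)"
      unfolding R_def using y m by (intro sum_mono mult_right_mono) auto
    also have "\<dots> = 2 * real m * S m" by (simp add: S_def sum_distrib_left)
    also have "2 * real m \<le> \<beta> m"
    proof -
      have "2 * real m * (N - 2) \<le> 4 * real m * (N - 1 - real m)"
        using Nm by (auto simp: algebra_simps)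
      thus ?thesis using N by (simp add: \<beta>_def le_divide_eq)
    qed
    hence "2 * real m * S m \<le> \<beta> m * S m" using S_nonneg m by (intro mult_right_mono) auto
    finally show ?case by simp
  next
    case (Suc k)
    have w: "w (Suc k) \<ge> 0"
      unfolding w_def using Suc.hyps Nm N by (intro divide_nonneg_nonneg) auto
    have "real (Suc k) * y (Suc k) \<le> real (Suc k) - 2 * S k"
      using cap[of "Suc k"] Suc.prems by (simp add: S_def atLeastLessThanSuc_atLeastAtMost)
    hence "w (Suc k) * (real (Suc k) * y (Suc k)) \<le> w (Suc k) * (real (Suc k) - 2 * S k)"
      using w by (rule mult_left_mono)
    \<comment> \<open>By \<open>tight\<close>, the weighted constraint has exactly the coefficient
      needed for the new variable.\<close>
    moreover have "2 * real (Suc k) * y (Suc k) - \<beta> (Suc k) * y (Suc k) = w (Suc k) * (real (Suc k) * y (Suc k))"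
      unfolding tight[of "Suc k", symmetric] by (simp only: algebra_simps)
    moreover have "R (Suc k) = R k + 2 * real (Suc k) * y (Suc k)"
      by (simp add: R_def)
    moreover have "\<alpha> k - \<beta> k * S k = \<alpha> (Suc k) - \<beta> (Suc k) * S k + w (Suc k) * (real (Suc k) - 2 * S k)"
      unfolding \<beta>_Suc[of k] \<alpha>_Suc[of k] by (simp only: algebra_simps)
    moreover have "\<beta> (Suc k) * S (Suc k) = \<beta> (Suc k) * S k + \<beta> (Suc k) * y (Suc k)"
      by (simp add: S_def distrib_left)
    moreover have "R k + \<alpha> k - \<beta> k * S k \<le> \<alpha> m" using Suc.IH Suc.prems by simp
    ultimately show ?case by linarith
  qed
  from this[of "n - 1"] have "R (n - 1) + \<alpha> (n - 1) - \<beta> (n - 1) * S (n - 1) \<le> \<alpha> m"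
    using m n by simp
  moreover have r: "real (n - 1) = N - 1" using n by (simp add: N_def of_nat_diff)
  have "\<beta> (n - 1) = 0" "\<alpha> (n - 1) = 0"
    unfolding \<beta>_def \<alpha>_def r by (simp_all add: algebra_simps)
  \<comment> \<open>Both parities of \<open>n\<close> lead to the same quotient in \<open>m\<close>,
    whose limit is \<open>5 / 12\<close>.\<close>
  moreover have "\<alpha> m = N * (N - 1) * ((5 * real m - 1) / (6 * (2 * real m - 1)))"
    using Nm
  proof
    assume "N = 2 * real m"
    moreover from this have "real m > 1" using N by simp
    ultimately show ?thesis by (simp add: \<alpha>_def divide_simps) (simp add: algebra_simps)
  next
    assume "N = 2 * real m + 1"
    moreover have "2 * real m > 1" using m by simp
    ultimately show ?thesis by (simp add: \<alpha>_def divide_simps) (simp add: algebra_simps)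
  qed
  moreover have "(5 * real m - 1) / (6 * (2 * real m - 1)) \<le> 5 / 12 + 1 / N"
  proof -
    have "(5 * real m - 1) / (6 * (2 * real m - 1)) = 5 / 12 + 1 / (4 * (2 * real m - 1))"
      using m by (simp add: field_simps)
    \<comment> \<open>Since \<open>m \<ge> 1\<close>,
      \<open>N \<le> 2 * real m + 1 \<le> 4 * (2 * real m - 1)\<close>.\<close>
    also have "1 / (4 * (2 * real m - 1)) \<le> 1 / N"
      using m N Nm by (intro divide_left_mono) auto
    finally show ?thesis by simp
  qed
  hence "N * (N - 1) * ((5 * real m - 1) / (6 * (2 * real m - 1))) \<le> N * (N - 1) * (5 / 12 + 1 / N)"
    using N by (intro mult_left_mono) auto
  moreover have "{1..n - 1} = {1..<n}" using n by auto
  ultimately show ?thesis by (simp add: R_def N_def)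
qed

section \<open>The recurrences as a feasible point of the linear program\<close>

text \<open>For \<open>i \<ge> 1\<close> and \<open>p\<close>, \<open>c\<close> in the unit
  interval, \<open>2 * c * p \<le> p + p \<le> i * p + 1\<close> keeps the numerator nonnegative,
  and \<open>i * p \<le> i\<close> bounds it above.\<close>

lemma free_avg_bounds:
  assumes "\<And>j. j \<in> {1..i} \<Longrightarrow> c j \<in> {0..1}"
  shows "free_avg c i \<in> {0..1}"
  using assms
proof (induction i)
  case (Suc i)
  show ?case
  proof (cases "i = 0")
    case False
    have f: "0 \<le> free_avg c i" "free_avg c i \<le> 1" using Suc by auto
    have c: "0 \<le> c (Suc i)" "c (Suc i) \<le> 1" using Suc.prems[of "Suc i"] by auto
    have "0 \<le> 2 * c (Suc i) * free_avg c i" using c f by simp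
    moreover have "2 * c (Suc i) * free_avg c i \<le> 2 * free_avg c i" using c f by (simp add: mult_left_le_one_le)
    moreover have "free_avg c i \<le> real i * free_avg c i"
      using mult_right_mono[of 1 "real i" "free_avg c i"] False f by simp
    moreover have "real i * free_avg c i \<le> real i" using f by (simp add: mult_left_le)
    ultimately have "0 \<le> real i * free_avg c i + 1 - 2 * c (Suc i) * free_avg c i"
      "real i * free_avg c i + 1 - 2 * c (Suc i) * free_avg c i \<le> real (Suc i)"
      using f by linarith+
    thus ?thesis using False by (auto simp: divide_le_eq)
  qed simp
qed simp

text \<open>The recurrence telescopes. Together with \<open>y\<^sub>k \<le> p\<^sub>k\<close>, which
  holds as \<open>c\<close> is at most 1, this is the capacity constraint.\<close>

lemma free_avg_eq_sum:
  assumes "k \<ge> 1"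
  shows "real k * free_avg c k = real k - 2 * (\<Sum>j=1..<k. c (Suc j) * free_avg c j)"
  using assms
proof (induction k rule: nat_induct_at_least)
  case (Suc k)
  thus ?case by (simp add: sum.atLeastLessThan_Suc)
qed simp

text \<open>Multiplying the recurrence for \<open>q\<^sub>i\<close> by \<open>i - 1\<close> makes
  \<open>i * (i - 1) * q\<^sub>i\<close> telescope to the objective.\<close>

lemma match_avg_eq_sum:
  "real (Suc k) * real k * match_avg c (Suc k) = (\<Sum>j=1..<Suc k. 2 * real j * (c (Suc j) * free_avg c j))"
proof (induction k)
  case (Suc k)
  have "real (Suc (Suc k)) * match_avg c (Suc (Suc k)) =
    2 * c (Suc (Suc k)) * free_avg c (Suc k) + real k * match_avg c (Suc k)"
    by (subst match_avg.simps(2)) (simp del: match_avg.simps free_avg.simps)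
  hence "real (Suc k) * (real (Suc (Suc k)) * match_avg c (Suc (Suc k))) =
    real (Suc k) * (2 * c (Suc (Suc k)) * free_avg c (Suc k) + real k * match_avg c (Suc k))"
    by (rule arg_cong)
  hence "real (Suc (Suc k)) * real (Suc k) * match_avg c (Suc (Suc k)) =
    real (Suc k) * real k * match_avg c (Suc k) + 2 * real (Suc k) * (c (Suc (Suc k)) * free_avg c (Suc k))"
    by (simp only: distrib_left mult_ac add_ac)
  thus ?case using Suc.IH by (simp del: match_avg.simps free_avg.simps)
qed simp

lemma match_avg_le:
  assumes n: "n \<ge> 3" and c: "\<And>i. i \<in> {1..n} \<Longrightarrow> c i \<in> {0..1}"
  shows "match_avg c n \<le> 5 / 12 + 1 / real n"
proof -
  have y: "0 \<le> c (Suc k) * free_avg c k" "c (Suc k) * free_avg c k \<le> free_avg c k"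
    if "k \<in> {1..<n}" for k
    using that c[of "Suc k"] free_avg_bounds[of k c] c
    by (auto simp: mult_left_le_one_le)
  have "(\<Sum>k=1..<n. 2 * real k * (c (Suc k) * free_avg c k)) \<le> real n * (real n - 1) * (5 / 12 + 1 / real n)"
  proof (rule matching_lp_bound[OF n y(1)])
    fix k assume k: "k \<in> {1..<n}"
    have "real k * (c (Suc k) * free_avg c k) \<le> real k * free_avg c k"
      using y(2)[OF k] by (intro mult_left_mono) auto
    thus "real k * (c (Suc k) * free_avg c k) + 2 * (\<Sum>j=1..<k. c (Suc j) * free_avg c j) \<le> real k"
      using free_avg_eq_sum[of k c] k by simp
  qed
  hence "real n * (real n - 1) * match_avg c n \<le> real n * (real n - 1) * (5 / 12 + 1 / real n)"
    using match_avg_eq_sum[of "n - 1" c] n by (simp add: of_nat_diff)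
  moreover have "real n * (real n - 1) > 0" using n by simp
  ultimately show ?thesis by (rule mult_left_le_imp_le)
qed

theorem theorem9:
  "\<exists>K::real. \<forall>n\<ge>2. \<forall>c::nat \<Rightarrow> real.
     (\<forall>i\<in>{1..n}. c i \<in> {0..1}) \<longrightarrow>
     measure_pmf.prob (ALG_matching n c) {M. {1, 2} \<in> M} \<le> 5 / 12 + K / real n"
\<comment> \<open>For \<open>n \<ge> 3\<close> the constant 1 is enough; with 2 the bound exceeds 1
  at \<open>n = 2\<close>, where the linear program bound does not apply.\<close>
proof (intro exI[of _ 2] allI impI)
  fix n :: nat and c :: "nat \<Rightarrow> real"
  assume n: "2 \<le> n" and c: "\<forall>i\<in>{1..n}. c i \<in> {0..1}"
  show "measure_pmf.prob (ALG_matching n c) {M. {1, 2} \<in> M} \<le> 5 / 12 + 2 / real n"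
  proof (cases "n = 2")
    case True
    hence "1 \<le> 5 / 12 + 2 / real n" by simp
    thus ?thesis by (rule order_trans[OF measure_pmf.prob_le_1])
  next
    case False
    hence "match_avg c n \<le> 5 / 12 + 1 / real n" using n c by (intro match_avg_le) auto
    moreover have "1 / real n \<le> 2 / real n" by (simp add: divide_right_mono)
    ultimately show ?thesis using prob_ALG_matching[of n c] n c by simp
  qed
qed

end
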